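(* Let $a,b,c>0$ be real numbers with $(c-a)(c-b)\ge 0$. Then the function $$x\mapsto \frac{F^2(a,b;c;x)}{F(2a,2b;2c;x)}$$ is increasing on $(0,1)$ (in the weak sense, i.e. nondecreasing). Moreover, $F^2(a,b;c;x)\ge F(2a,2b;2c;x)$ for all $x\in(0,1)$.
   Context: $F(a,b;c;x)=\sum_{k=0}^\infty \frac{(a)_k(b)_k}{(c)_k\,k!}x^k$ for $|x|<1$ is the Gaussian hypergeometric function, where $(t)_k=t(t+1)\cdots(t+k-1)$, $(t)_0=1$. $F^2(a,b;c;x)$ means $(F(a,b;c;x))^2$. *)

theory Defs
  imports "HOL-Analysis.Analysis"
begin

(* Meaningful where the series converges: for \<bar>x\<bar> < 1 whenever c is not a nonpositive integer
   (in particular for c > 0). *)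
definition hyperF :: "real \<Rightarrow> real \<Rightarrow> real \<Rightarrow> real \<Rightarrow> real" where
  "hyperF a b c x =
     (\<Sum>k. pochhammer a k * pochhammer b k / (pochhammer c k * fact k) * x ^ k)"

lemma hyperF_eq_eval_fps_hypergeo:
  "hyperF a b c x = eval_fps (fps_hypergeo [a, b] [c] 1) x"
  by (simp add: hyperF_def eval_fps_def)

end

theory Submission
  imports Defs "HOL-Real_Asymp.Real_Asymp"
begin

text \<open>
  Write \<open>F(a,b;c;x)\<^sup>2 = \<Sum>u\<^sub>n x\<^sup>n\<close> by the Cauchy product, and let \<open>v\<^sub>n\<close> be the (positive)
  coefficients of \<open>F(2a,2b;2c;x)\<close>. A quotient of two power series with positive
  denominator coefficients is nondecreasing for positive arguments as soon as the
  quotients \<open>u\<^sub>n / v\<^sub>n\<close> of the coefficients are (a Chebyshev-type correlation argument,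
  \<open>power_series_quotient_cross_le\<close>); moreover \<open>u\<^sub>0 / v\<^sub>0 = 1\<close>, so monotonicity of
  \<open>u\<^sub>n / v\<^sub>n\<close> also yields \<open>u\<^sub>n \<ge> v\<^sub>n\<close> and hence the second claim.

  For the monotonicity of \<open>u\<^sub>n / v\<^sub>n\<close>, let
  \<open>W\<^sub>a(n,k) = (a)\<^sub>k (a)\<^sub>n\<^sub>-\<^sub>k / (2a)\<^sub>n\<close>. This is the probability that a Polya urn started with
  mass \<open>a\<close> of each of two colours produces a given sequence of \<open>n\<close> colours, \<open>k\<close> of which are
  the first colour. One finds
  \<open>u\<^sub>n / v\<^sub>n = \<Sum>\<^sub>k (n choose k) W\<^sub>a W\<^sub>b / W\<^sub>c (n,k)\<close>. Drawing one more colour (Pascal's rule)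
  multiplies the summand at \<open>(n,k)\<close> by
  \<open>\<alpha>\<beta>/\<gamma> + (1-\<alpha>)(1-\<beta>)/(1-\<gamma>)\<close>, where \<open>\<alpha> = (a+k)/(2a+n)\<close> is the chance of the first colour
  and \<open>\<beta>\<close>, \<open>\<gamma>\<close> are the same for \<open>b\<close> and \<open>c\<close>. This factor equals
  \<open>1 + (\<alpha>-\<gamma>)(\<beta>-\<gamma>) / (\<gamma>(1-\<gamma>))\<close>, and since
  \<open>\<alpha> - \<gamma> = (2k-n)(c-a) / ((2a+n)(2c+n))\<close>, the product \<open>(\<alpha>-\<gamma>)(\<beta>-\<gamma>)\<close> has the sign of
  \<open>(c-a)(c-b)\<close>. So every summand grows (\<open>urn_quotient_step\<close>).
\<close>

section \<open>Quotients of power series\<close>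

text \<open>
  Under weights proportional to \<open>q\<close> instead of \<open>p\<close>, where \<open>q i / p i\<close> increases with \<open>i\<close>, the mean
  of an increasing sequence \<open>R\<close> is larger: in the double sum over \<open>(i,j)\<close> of
  \<open>(R i - R j) (q i p j - p i q j)\<close> both factors have the same sign.
\<close>

lemma weighted_mean_mono_sum:
  fixes R p q :: "nat \<Rightarrow> real"
  assumes R: "incseq R"
    and lr: "\<And>i j. i \<le> j \<Longrightarrow> q i * p j \<le> p i * q j"
  shows "(\<Sum>i<N. R i * p i) * (\<Sum>i<N. q i) \<le> (\<Sum>i<N. R i * q i) * (\<Sum>i<N. p i)"
proof -
  have "0 \<le> (R i - R j) * (q i * p j - p i * q j)" for i j
  proof (cases "i \<le> j")
    case True
    then show ?thesis
      using lr[of i j] incseqD[OF R, of i j] by (intro mult_nonpos_nonpos) auto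
  next
    case False
    then show ?thesis
      using lr[of j i] incseqD[OF R, of j i] by (intro mult_nonneg_nonneg) (auto simp: mult.commute)
  qed
  then have "0 \<le> (\<Sum>i<N. \<Sum>j<N. (R i - R j) * (q i * p j - p i * q j))"
    by (intro sum_nonneg) auto
  also have "\<dots> = (\<Sum>i<N. \<Sum>j<N. (R i * q i) * p j - (R i * p i) * q j
                                 - q i * (R j * p j) + p i * (R j * q j))"
    by (intro sum.cong refl) (simp add: algebra_simps)
  also have "\<dots> = 2 * ((\<Sum>i<N. R i * q i) * (\<Sum>i<N. p i) - (\<Sum>i<N. R i * p i) * (\<Sum>i<N. q i))"
    by (simp add: sum.distrib sum_subtractf flip: sum_product)
  finally show ?thesis by simp
qed

text \<open>The Biernacki--Krzyz monotonicity rule, with the denominators cleared: the weights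
  \<open>v\<^sub>i y\<^sup>i\<close> and \<open>v\<^sub>i x\<^sup>i\<close> have the increasing quotient \<open>(y/x)\<^sup>i\<close>, so the inequality holds for
  all partial sums.\<close>

lemma power_series_quotient_cross_le:
  fixes R v :: "nat \<Rightarrow> real"
  assumes R: "incseq R" and v: "\<And>n. 0 \<le> v n" and xy: "0 \<le> x" "x \<le> y"
    and sums: "summable (\<lambda>n. v n * x ^ n)" "summable (\<lambda>n. v n * y ^ n)"
      "summable (\<lambda>n. R n * v n * x ^ n)" "summable (\<lambda>n. R n * v n * y ^ n)"
  shows "(\<Sum>n. R n * v n * x ^ n) * (\<Sum>n. v n * y ^ n)
       \<le> (\<Sum>n. R n * v n * y ^ n) * (\<Sum>n. v n * x ^ n)"
proof (rule LIMSEQ_le)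
  have lr: "(v i * y ^ i) * (v j * x ^ j) \<le> (v i * x ^ i) * (v j * y ^ j)" if "i \<le> j" for i j
  proof -
    have "x ^ (j - i) \<le> y ^ (j - i)"
      using xy by (intro power_mono)
    then have "(v i * v j * x ^ i * y ^ i) * x ^ (j - i) \<le> (v i * v j * x ^ i * y ^ i) * y ^ (j - i)"
      using v xy by (intro mult_left_mono) auto
    moreover have "x ^ j = x ^ i * x ^ (j - i)" "y ^ j = y ^ i * y ^ (j - i)"
      using that by (simp_all flip: power_add)
    ultimately show ?thesis
      by (simp add: mult_ac)
  qed
  show "\<exists>N. \<forall>n\<ge>N. (\<Sum>i<n. R i * v i * x ^ i) * (\<Sum>i<n. v i * y ^ i)
              \<le> (\<Sum>i<n. R i * v i * y ^ i) * (\<Sum>i<n. v i * x ^ i)"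
    using weighted_mean_mono_sum[OF R lr] by (auto simp: mult.assoc)
qed (intro tendsto_mult summable_LIMSEQ sums)+

section \<open>The hypergeometric series\<close>

definition hyper_coeff :: "real \<Rightarrow> real \<Rightarrow> real \<Rightarrow> nat \<Rightarrow> real" where
  "hyper_coeff a b c n = pochhammer a n * pochhammer b n / (pochhammer c n * fact n)"

lemma hyperF_conv_hyper_coeff: "hyperF a b c x = (\<Sum>n. hyper_coeff a b c n * x ^ n)"
  by (simp add: hyperF_def hyper_coeff_def)

lemma hyper_coeff_pos:
  assumes "a > 0" "b > 0" "c > 0"
  shows "hyper_coeff a b c n > 0"
  using assms by (simp add: hyper_coeff_def pochhammer_pos)

lemma hyper_coeff_Suc:
  "hyper_coeff a b c (Suc n) =
     hyper_coeff a b c n * ((a + real n) * (b + real n) / ((c + real n) * (real n + 1)))"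
  by (simp add: hyper_coeff_def pochhammer_Suc mult_ac add_ac)

lemma abs_summable_hyper_coeff:
  assumes "a > 0" "b > 0" "c > 0" and x: "\<bar>x\<bar> < 1"
  shows "summable (\<lambda>n. norm (hyper_coeff a b c n * x ^ n))"
proof (rule abs_summable_in_conv_radius)
  have "(\<lambda>n. norm (hyper_coeff a b c n) / norm (hyper_coeff a b c (Suc n))) =
        (\<lambda>n. (c + real n) * (real n + 1) / ((a + real n) * (b + real n)))"
  proof
    fix n
    show "norm (hyper_coeff a b c n) / norm (hyper_coeff a b c (Suc n)) =
        (c + real n) * (real n + 1) / ((a + real n) * (b + real n))"
      using hyper_coeff_pos[OF assms(1-3), of n] assms(1-3)
      by (simp add: hyper_coeff_Suc abs_mult)
  qed
  moreover have "(\<lambda>n. (c + real n) * (real n + 1) / ((a + real n) * (b + real n))) \<longlonglongrightarrow> 1"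
    by real_asymp
  ultimately have "conv_radius (hyper_coeff a b c) = ereal 1"
    using hyper_coeff_pos[OF assms(1-3)]
    by (intro conv_radius_ratio_limit) (auto simp: less_imp_neq[symmetric])
  then show "ereal (norm x) < conv_radius (hyper_coeff a b c)"
    using x by simp
qed

lemma summable_hyper_coeff:
  assumes "a > 0" "b > 0" "c > 0" "\<bar>x\<bar> < 1"
  shows "summable (\<lambda>n. hyper_coeff a b c n * x ^ n)"
  using abs_summable_hyper_coeff[OF assms] by (rule summable_norm_cancel)

lemma hyperF_pos:
  assumes "a > 0" "b > 0" "c > 0" "0 < x" "x < 1"
  shows "hyperF a b c x > 0"
  unfolding hyperF_conv_hyper_coeff
  using assms by (intro suminf_pos summable_hyper_coeff mult_pos_pos hyper_coeff_pos zero_less_power) auto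

section \<open>The coefficients as averages over a Polya urn\<close>

definition urn_weight :: "real \<Rightarrow> nat \<Rightarrow> nat \<Rightarrow> real" where
  "urn_weight a n k = pochhammer a k * pochhammer a (n - k) / pochhammer (2 * a) n"

definition urn_quotient :: "real \<Rightarrow> real \<Rightarrow> real \<Rightarrow> nat \<Rightarrow> nat \<Rightarrow> real" where
  "urn_quotient a b c n k = urn_weight a n k * urn_weight b n k / urn_weight c n k"

definition coeff_ratio :: "real \<Rightarrow> real \<Rightarrow> real \<Rightarrow> nat \<Rightarrow> real" where
  "coeff_ratio a b c n = (\<Sum>k\<le>n. real (n choose k) * urn_quotient a b c n k)"

lemma urn_weight_pos: "a > 0 \<Longrightarrow> urn_weight a n k > 0"
  by (simp add: urn_weight_def pochhammer_pos)

lemma urn_weight_Suc_Suc: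
  "urn_weight a (Suc n) (Suc k) = urn_weight a n k * ((a + real k) / (2 * a + real n))"
  by (simp add: urn_weight_def pochhammer_Suc mult_ac add_ac)

lemma urn_weight_Suc:
  assumes "a > 0" "k \<le> n"
  shows "urn_weight a (Suc n) k = urn_weight a n k * (1 - (a + real k) / (2 * a + real n))"
proof -
  have "1 - (a + real k) / (2 * a + real n) = (a + real (n - k)) / (2 * a + real n)"
    using assms by (simp add: divide_simps of_nat_diff)
  then show ?thesis
    using assms(2) by (simp only: urn_weight_def pochhammer_Suc Suc_diff_le) (simp add: mult_ac)
qed

text \<open>
  Replacing \<open>\<gamma>\<close> by \<open>\<alpha>\<close> or by \<open>\<beta>\<close> makes the left-hand side equal to \<open>1\<close>; this explains the two
  linear factors on the right.
\<close>

lemma two_point_quotient: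
  fixes \<alpha> \<beta> \<gamma> :: real
  assumes "0 < \<gamma>" "\<gamma> < 1"
  shows "\<alpha> * \<beta> / \<gamma> + (1 - \<alpha>) * (1 - \<beta>) / (1 - \<gamma>) = 1 + (\<alpha> - \<gamma>) * (\<beta> - \<gamma>) / (\<gamma> * (1 - \<gamma>))"
  using assms by (simp add: divide_simps) algebra

text \<open>
  The two colours start with equal mass, so every drawing probability is \<open>1/2\<close> plus a multiple of
  \<open>2k - n\<close>, with a multiplier that decreases in the initial mass. Hence the deviations of \<open>a\<close>
  and of \<open>b\<close> from \<open>c\<close> have the same sign whenever \<open>a\<close> and \<open>b\<close> lie on the same side of \<open>c\<close>.
\<close>

lemma draw_probability_deviations:
  fixes a b c :: real
  assumes "a > 0" "b > 0" "c > 0" "(c - a) * (c - b) \<ge> 0"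
  shows "((a + real k) / (2 * a + real n) - (c + real k) / (2 * c + real n)) *
         ((b + real k) / (2 * b + real n) - (c + real k) / (2 * c + real n)) \<ge> 0"
proof -
  have dev: "(t + real k) / (2 * t + real n) - (c + real k) / (2 * c + real n) =
      (2 * real k - real n) * (c - t) / ((2 * t + real n) * (2 * c + real n))" if "t > 0" for t
    using that assms(3) add_pos_nonneg[of "2 * t" "real n"] add_pos_nonneg[of "2 * c" "real n"]
    by (simp add: divide_simps) (simp add: algebra_simps)
  let ?D = "(2 * a + real n) * (2 * c + real n) * ((2 * b + real n) * (2 * c + real n))"
  have "0 \<le> (2 * real k - real n)\<^sup>2 * ((c - a) * (c - b)) / ?D"
    using assms(1-3) by (intro divide_nonneg_nonneg mult_nonneg_nonneg[OF zero_le_power2 assms(4)]) simp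
  then show ?thesis
    unfolding dev[OF assms(1)] dev[OF assms(2)] by (simp add: power2_eq_square mult_ac)
qed

lemma urn_quotient_step:
  assumes "a > 0" "b > 0" "c > 0" "(c - a) * (c - b) \<ge> 0" "k \<le> n"
  shows "urn_quotient a b c n k \<le> urn_quotient a b c (Suc n) k + urn_quotient a b c (Suc n) (Suc k)"
proof -
  define \<alpha> where "\<alpha> = (a + real k) / (2 * a + real n)"
  define \<beta> where "\<beta> = (b + real k) / (2 * b + real n)"
  define \<gamma> where "\<gamma> = (c + real k) / (2 * c + real n)"
  have \<gamma>: "0 < \<gamma>" "\<gamma> < 1"
    using assms by (simp_all add: \<gamma>_def divide_simps add_pos_nonneg)
  have "urn_quotient a b c (Suc n) k + urn_quotient a b c (Suc n) (Suc k) =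
        urn_quotient a b c n k * (\<alpha> * \<beta> / \<gamma> + (1 - \<alpha>) * (1 - \<beta>) / (1 - \<gamma>))"
    unfolding urn_quotient_def urn_weight_Suc_Suc urn_weight_Suc[OF assms(1,5)]
      urn_weight_Suc[OF assms(2,5)] urn_weight_Suc[OF assms(3,5)]
      \<alpha>_def[symmetric] \<beta>_def[symmetric] \<gamma>_def[symmetric]
    by (simp add: distrib_left mult_ac)
  also have "\<dots> \<ge> urn_quotient a b c n k * 1"
  proof (rule mult_left_mono)
    show "1 \<le> \<alpha> * \<beta> / \<gamma> + (1 - \<alpha>) * (1 - \<beta>) / (1 - \<gamma>)"
      unfolding two_point_quotient[OF \<gamma>]
      using draw_probability_deviations[OF assms(1-4), of k n] \<gamma>
      by (simp add: \<alpha>_def[symmetric] \<beta>_def[symmetric] \<gamma>_def[symmetric])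
    show "0 \<le> urn_quotient a b c n k"
      using urn_weight_pos[of a n k] urn_weight_pos[of b n k] urn_weight_pos[of c n k] assms
      by (simp add: urn_quotient_def)
  qed
  finally show ?thesis by simp
qed

text \<open>Pascal's rule: the last of \<open>n + 1\<close> draws has either the second or the first colour.\<close>

lemma sum_binomial_Suc:
  fixes h :: "nat \<Rightarrow> real"
  shows "(\<Sum>k\<le>Suc n. real (Suc n choose k) * h k) = (\<Sum>k\<le>n. real (n choose k) * (h k + h (Suc k)))"
proof -
  have "(\<Sum>k\<le>Suc n. real (Suc n choose k) * h k) =
        h 0 + (\<Sum>k\<le>n. real (n choose Suc k) * h (Suc k)) + (\<Sum>k\<le>n. real (n choose k) * h (Suc k))"
    by (simp add: sum.atMost_Suc_shift sum.distrib ring_distribs del: sum.atMost_Suc)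
  also have "h 0 + (\<Sum>k\<le>n. real (n choose Suc k) * h (Suc k)) = (\<Sum>k\<le>Suc n. real (n choose k) * h k)"
    by (simp add: sum.atMost_Suc_shift del: sum.atMost_Suc)
  also have "\<dots> = (\<Sum>k\<le>n. real (n choose k) * h k)"
    by simp
  finally show ?thesis
    by (simp add: sum.distrib ring_distribs)
qed

lemma coeff_ratio_0: "coeff_ratio a b c 0 = 1"
  by (simp add: coeff_ratio_def urn_quotient_def urn_weight_def)

lemma incseq_coeff_ratio:
  assumes "a > 0" "b > 0" "c > 0" "(c - a) * (c - b) \<ge> 0"
  shows "incseq (coeff_ratio a b c)"
proof (rule incseq_SucI)
  fix n
  show "coeff_ratio a b c n \<le> coeff_ratio a b c (Suc n)"
    unfolding coeff_ratio_def sum_binomial_Suc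
    using urn_quotient_step[OF assms] by (intro sum_mono mult_left_mono) auto
qed

lemma hyper_coeff_convolution:
  assumes "a > 0" "b > 0" "c > 0"
  shows "(\<Sum>k\<le>n. hyper_coeff a b c k * hyper_coeff a b c (n - k)) =
         coeff_ratio a b c n * hyper_coeff (2 * a) (2 * b) (2 * c) n"
proof -
  have "hyper_coeff a b c k * hyper_coeff a b c (n - k) =
        real (n choose k) * urn_quotient a b c n k * hyper_coeff (2 * a) (2 * b) (2 * c) n"
    if "k \<le> n" for k
  proof -
    have "pochhammer (2 * a) n > 0" "pochhammer (2 * b) n > 0" "pochhammer (2 * c) n > 0"
      using assms by (simp_all add: pochhammer_pos)
    then show ?thesis
      by (simp add: hyper_coeff_def urn_quotient_def urn_weight_def binomial_fact[OF that] mult_ac)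
  qed
  then show ?thesis
    by (simp add: coeff_ratio_def sum_distrib_right)
qed

lemma hyperF_square_sums:
  assumes "a > 0" "b > 0" "c > 0" "\<bar>x\<bar> < 1"
  shows "(\<lambda>n. coeff_ratio a b c n * hyper_coeff (2 * a) (2 * b) (2 * c) n * x ^ n)
           sums (hyperF a b c x)\<^sup>2"
proof -
  let ?t = "\<lambda>n. hyper_coeff a b c n * x ^ n"
  have "(\<Sum>k\<le>n. ?t k * ?t (n - k)) =
        coeff_ratio a b c n * hyper_coeff (2 * a) (2 * b) (2 * c) n * x ^ n" for n
  proof -
    have "(\<Sum>k\<le>n. ?t k * ?t (n - k)) =
          (\<Sum>k\<le>n. hyper_coeff a b c k * hyper_coeff a b c (n - k)) * x ^ n"
      unfolding sum_distrib_right
    proof (rule sum.cong)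
      fix k assume "k \<in> {..n}"
      then have "x ^ n = x ^ k * x ^ (n - k)"
        by (simp flip: power_add)
      then show "?t k * ?t (n - k) = hyper_coeff a b c k * hyper_coeff a b c (n - k) * x ^ n"
        by simp
    qed simp
    then show ?thesis
      by (simp add: hyper_coeff_convolution[OF assms(1-3)])
  qed
  with Cauchy_product_sums[OF abs_summable_hyper_coeff[OF assms] abs_summable_hyper_coeff[OF assms]]
  show ?thesis
    by (simp add: hyperF_conv_hyper_coeff power2_eq_square)
qed

section \<open>Monotonicity and lower bound\<close>

theorem theorem4p1:
  fixes a b c :: real
  assumes "a > 0" and "b > 0" and "c > 0"
    and "(c - a) * (c - b) \<ge> 0"
  shows "mono_on {0<..<1} (\<lambda>x. (hyperF a b c x)\<^sup>2 / hyperF (2 * a) (2 * b) (2 * c) x)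
    \<and> (\<forall>x\<in>{0<..<1}. (hyperF a b c x)\<^sup>2 \<ge> hyperF (2 * a) (2 * b) (2 * c) x)"
proof (intro conjI mono_onI ballI)
  let ?R = "coeff_ratio a b c" and ?v = "hyper_coeff (2 * a) (2 * b) (2 * c)"
  have pos2: "2 * a > 0" "2 * b > 0" "2 * c > 0"
    using assms by simp_all
  have v: "?v n \<ge> 0" for n
    using hyper_coeff_pos[OF pos2, of n] by simp
  have square: "(\<lambda>n. ?R n * ?v n * x ^ n) sums (hyperF a b c x)\<^sup>2" if "x \<in> {0<..<1}" for x
    using that by (intro hyperF_square_sums assms) auto
  have summ: "summable (\<lambda>n. ?v n * x ^ n)" if "x \<in> {0<..<1}" for x
    using that by (intro summable_hyper_coeff pos2) auto
  note R = incseq_coeff_ratio[OF assms]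
  {
    fix x y :: real
    assume xy: "x \<in> {0<..<1}" "y \<in> {0<..<1}" "x \<le> y"
    have "(hyperF a b c x)\<^sup>2 * hyperF (2 * a) (2 * b) (2 * c) y
        \<le> (hyperF a b c y)\<^sup>2 * hyperF (2 * a) (2 * b) (2 * c) x"
      using power_series_quotient_cross_le[OF R v _ xy(3) summ summ sums_summable[OF square]
          sums_summable[OF square]] xy
      by (simp add: hyperF_conv_hyper_coeff[of "2 * a"] sums_unique[OF square, symmetric])
    moreover have "hyperF (2 * a) (2 * b) (2 * c) x > 0" "hyperF (2 * a) (2 * b) (2 * c) y > 0"
      using xy by (auto intro!: hyperF_pos pos2)
    ultimately show "(hyperF a b c x)\<^sup>2 / hyperF (2 * a) (2 * b) (2 * c) x
        \<le> (hyperF a b c y)\<^sup>2 / hyperF (2 * a) (2 * b) (2 * c) y"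
      by (simp add: divide_simps)
  next
    fix x :: real
    assume x: "x \<in> {0<..<1}"
    have "?v n * x ^ n \<le> ?R n * ?v n * x ^ n" for n
    proof -
      have "1 \<le> ?R n"
        using incseqD[OF R, of 0 n] by (simp add: coeff_ratio_0)
      then have "1 * (?v n * x ^ n) \<le> ?R n * (?v n * x ^ n)"
        using v[of n] x by (intro mult_right_mono) auto
      then show ?thesis
        by (simp add: mult.assoc)
    qed
    then show "hyperF (2 * a) (2 * b) (2 * c) x \<le> (hyperF a b c x)\<^sup>2"
      unfolding hyperF_conv_hyper_coeff[of "2 * a"]
      using sums_le[OF _ summable_sums[OF summ[OF x]] square[OF x]] by blast
  }
qed

end
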